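(* Let $\vartheta\in\mathcal{G}(\mathbb{R}^d)$ be a Gaussian distribution with parameters $(\mu,\Sigma)$. A Gaussian $\varrho\in\mathcal{G}(\mathbb{R}^d)$ with parameters $(\mu',\Sigma')$ is in the orbit of $\vartheta$ under the action of the orthogonal group $O(d)$ only if $\|\mu'\|_2=\|\mu\|_2$ and $\Sigma'$ has the same eigenvalues as $\Sigma$.
   Context: $\mathcal{G}(\mathbb{R}^d)$ is the set of (possibly degenerate) Gaussian distributions $\mathcal{N}(\mu,\Sigma)$ on $\mathbb{R}^d$, identified with the set of pairs $(\mu,\Sigma)$ where $\mu\in\mathbb{R}^d$ and $\Sigma$ is a symmetric positive semidefinite $d\times d$ real matrix. A group of $d\times d$ invertible matrices acts on $\mathcal{G}(\mathbb{R}^d)$ by pushforward: $A\cdot\mathcal{N}(\mu,\Sigma)=\mathcal{N}(A\mu,A\Sigma A^\top)$. *)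

theory Defs
  imports "HOL-Analysis.Analysis" "HOL-Algebra.Group_Action"
begin

definition symmetric_matrix :: "real ^ 'n ^ 'n \<Rightarrow> bool" where
  "symmetric_matrix S \<longleftrightarrow> transpose S = S"

definition psd_matrix :: "real ^ 'n ^ 'n \<Rightarrow> bool" where
  "psd_matrix S \<longleftrightarrow> symmetric_matrix S \<and> (\<forall>x. 0 \<le> x \<bullet> (S *v x))"

text \<open>A possibly degenerate Gaussian distribution on \<open>\<real>\<^sup>d\<close>, where \<open>d = CARD('n)\<close>,
  is identified with its pair of parameters (mean, covariance).\<close>

type_synonym 'n gaussian = "(real ^ 'n) \<times> (real ^ 'n ^ 'n)"

definition gaussians :: "('n::finite) gaussian set" where
  "gaussians = {(\<mu>, S). psd_matrix S}"

definition orthogonal_group :: "(real ^ 'n ^ 'n) monoid" where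
  "orthogonal_group = \<lparr>carrier = {A. orthogonal_matrix A}, mult = (**), one = mat 1\<rparr>"

text \<open>The restriction to \<^const>\<open>gaussians\<close> is needed because \<^locale>\<open>group_action\<close> acts by
  bijections that are extensional on the set acted upon.\<close>

definition gaussian_action :: "real ^ 'n ^ 'n \<Rightarrow> ('n::finite) gaussian \<Rightarrow> 'n gaussian" where
  "gaussian_action A = (\<lambda>(\<mu>, S) \<in> gaussians. (A *v \<mu>, A ** S ** transpose A))"

definition eigenspace :: "real ^ 'n ^ 'n \<Rightarrow> real \<Rightarrow> (real ^ 'n) set" where
  "eigenspace S c = {v. S *v v = c *\<^sub>R v}"

definition eigenvalues :: "real ^ 'n ^ 'n \<Rightarrow> real set" where
  "eigenvalues S = {c. \<exists>v. v \<noteq> 0 \<and> v \<in> eigenspace S c}"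

text \<open>The geometric multiplicity; it coincides with the algebraic one for symmetric matrices,
  whose eigenvalues, moreover, are all real.\<close>

definition eigenvalue_multiplicity :: "real ^ 'n ^ 'n \<Rightarrow> real \<Rightarrow> nat" where
  "eigenvalue_multiplicity S c = dim (eigenspace S c)"

definition same_eigenvalues :: "real ^ 'n ^ 'n \<Rightarrow> real ^ 'n ^ 'n \<Rightarrow> bool" where
  "same_eigenvalues S T \<longleftrightarrow> eigenvalues S = eigenvalues T \<and>
     (\<forall>c \<in> eigenvalues T. eigenvalue_multiplicity S c = eigenvalue_multiplicity T c)"

lemma group_orthogonal_group: "group (orthogonal_group :: (real ^ 'n ^ 'n) monoid)"
proof (rule groupI)
  fix A :: "real ^ 'n ^ 'n"
  assume "A \<in> carrier orthogonal_group"
  then show "\<exists>B \<in> carrier orthogonal_group. B \<otimes>\<^bsub>orthogonal_group\<^esub> A = \<one>\<^bsub>orthogonal_group\<^esub>"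
    by (intro bexI[of _ "transpose A"]) (simp_all add: orthogonal_group_def orthogonal_matrix_def)
qed (simp_all add: orthogonal_group_def orthogonal_matrix_mul orthogonal_matrix_id
       matrix_mul_assoc)

lemma gaussian_action_closed:
  assumes "p \<in> gaussians"
  shows "gaussian_action A p \<in> gaussians"
proof -
  obtain \<mu> S where p: "p = (\<mu>, S)" by (cases p)
  have S: "transpose S = S" "\<And>x. 0 \<le> x \<bullet> (S *v x)"
    using assms by (auto simp: p gaussians_def psd_matrix_def symmetric_matrix_def)
  have "x \<bullet> ((A ** S ** transpose A) *v x) = (transpose A *v x) \<bullet> (S *v (transpose A *v x))" for x
    by (simp add: dot_lmul_matrix flip: matrix_vector_mul_assoc)
  then show ?thesis
    using assms S by (simp add: p gaussian_action_def gaussians_def psd_matrix_def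
        symmetric_matrix_def matrix_transpose_mul matrix_mul_assoc)
qed

lemma gaussian_action_mult:
  assumes "p \<in> gaussians"
  shows "gaussian_action (A ** B) p = gaussian_action A (gaussian_action B p)"
  using assms gaussian_action_closed[OF assms, of B]
  by (cases p) (simp add: gaussian_action_def matrix_transpose_mul matrix_mul_assoc
      matrix_vector_mul_assoc)

lemma gaussian_action_one: "p \<in> gaussians \<Longrightarrow> gaussian_action (mat 1) p = p"
  by (cases p) (simp add: gaussian_action_def transpose_mat)

lemma gaussian_action_Bij:
  assumes "orthogonal_matrix A"
  shows "gaussian_action A \<in> Bij gaussians"
proof -
  have "bij_betw (gaussian_action A) gaussians gaussians"
    using assms
    by (intro bij_betw_byWitness[where f' = "gaussian_action (transpose A)"])
      (auto simp: gaussian_action_closed gaussian_action_one orthogonal_matrix_def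
        simp flip: gaussian_action_mult)
  then show ?thesis
    by (simp add: Bij_def gaussian_action_def)
qed

lemma group_action_gaussian_action: "group_action orthogonal_group gaussians gaussian_action"
proof (intro group_action.intro group_hom.intro group_hom_axioms.intro)
  show "gaussian_action \<in> hom orthogonal_group (BijGroup gaussians)"
  proof (rule homI)
    fix A B :: "real ^ 'n ^ 'n"
    assume "A \<in> carrier orthogonal_group" "B \<in> carrier orthogonal_group"
    then have AB: "orthogonal_matrix A" "orthogonal_matrix B"
      by (simp_all add: orthogonal_group_def)
    have "gaussian_action (A ** B) = compose gaussians (gaussian_action A) (gaussian_action B)"
    proof (rule extensionalityI[of _ gaussians])
      show "gaussian_action (A ** B) \<in> extensional gaussians"
        by (simp add: gaussian_action_def)
    qed (simp_all add: compose_eq gaussian_action_mult)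
    then show "gaussian_action (A \<otimes>\<^bsub>orthogonal_group\<^esub> B) =
        gaussian_action A \<otimes>\<^bsub>BijGroup gaussians\<^esub> gaussian_action B"
      using AB by (simp add: orthogonal_group_def BijGroup_def gaussian_action_Bij)
  qed (simp add: orthogonal_group_def BijGroup_def gaussian_action_Bij)
qed (simp_all add: group_orthogonal_group group_BijGroup)

end

theory Submission
  imports Defs
begin

text \<open>A point of the orbit has the form (A \<mu>, A \<Sigma> A^T) with A orthogonal.
  Orthogonal maps preserve the norm, which settles the means. As A^T is the inverse of A, the
  covariances are similar: A maps each eigenspace of \<Sigma> bijectively onto that of A \<Sigma>
  A^T for the same scalar (\<open>eigenspace_orthogonal_conjugate\<close>), so eigenvalues and
  multiplicities agree (\<open>same_eigenvalues_orthogonal_conjugate\<close>).\<close>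

lemma eigenspace_orthogonal_conjugate:
  fixes A S :: "real ^ 'n ^ 'n"
  assumes "orthogonal_matrix A"
  shows "eigenspace (A ** S ** transpose A) c = (*v) A ` eigenspace S c"
proof (intro equalityI subsetI)
  \<comment> \<open>The simp rule \<open>transpose_matrix_vector\<close> would turn
    \<open>transpose A *v v\<close> into \<open>v v* A\<close> and hide these cancellations, so it
    is switched off here and below.\<close>
  have inverse: "transpose A *v (A *v v) = v" "A *v (transpose A *v v) = v" for v
    using assms by (simp_all add: orthogonal_matrix_def matrix_vector_mul_assoc
        del: transpose_matrix_vector)
  {
    fix v assume "v \<in> eigenspace (A ** S ** transpose A) c"
    then have "A *v (S *v (transpose A *v v)) = c *\<^sub>R v"
      by (simp add: eigenspace_def del: transpose_matrix_vector flip: matrix_vector_mul_assoc)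
    \<comment> \<open>Applying \<open>transpose A\<close> to both sides cancels the outer
      \<open>A\<close>.\<close>
    then have "S *v (transpose A *v v) = c *\<^sub>R (transpose A *v v)"
      by (metis inverse(1) matrix_vector_mult_scaleR)
    then show "v \<in> (*v) A ` eigenspace S c"
      by (intro image_eqI[of _ _ "transpose A *v v"]) (simp_all add: eigenspace_def inverse
          del: transpose_matrix_vector)
  next
    fix v assume "v \<in> (*v) A ` eigenspace S c"
    then show "v \<in> eigenspace (A ** S ** transpose A) c"
      by (auto simp: eigenspace_def inverse matrix_vector_mult_scaleR
          simp del: transpose_matrix_vector simp flip: matrix_vector_mul_assoc)
  }
qed

text \<open>An injective linear map sends nonzero eigenvectors to nonzero ones and preserves the
  dimension of every eigenspace.\<close>

lemma same_eigenvalues_orthogonal_conjugate: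
  fixes A S :: "real ^ 'n ^ 'n"
  assumes "orthogonal_matrix A"
  shows "same_eigenvalues (A ** S ** transpose A) S"
proof -
  have "orthogonal_transformation ((*v) A)"
    using assms by (simp add: orthogonal_transformation_matrix)
  then have inj: "inj ((*v) A)"
    by (rule orthogonal_transformation_inj)
  then have nonzero: "A *v v \<noteq> 0 \<longleftrightarrow> v \<noteq> 0" for v
    by (metis injD matrix_vector_mult_0_right)
  have "eigenvalues (A ** S ** transpose A) = eigenvalues S"
    unfolding eigenvalues_def eigenspace_orthogonal_conjugate[OF assms]
    using nonzero by blast
  moreover have "dim ((*v) A ` eigenspace S c) = dim (eigenspace S c)" for c
    using inj by (intro dim_image_eq) (auto intro: inj_on_subset)
  ultimately show ?thesis
    by (simp add: same_eigenvalues_def eigenvalue_multiplicity_def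
        eigenspace_orthogonal_conjugate[OF assms])
qed

theorem proposition4p1:
  fixes \<mu> \<mu>' :: "real ^ 'n" and \<Sigma> \<Sigma>' :: "real ^ 'n ^ 'n"
  assumes "(\<mu>, \<Sigma>) \<in> gaussians"
    and "(\<mu>', \<Sigma>') \<in> gaussians"
    and "(\<mu>', \<Sigma>') \<in> orbit orthogonal_group gaussian_action (\<mu>, \<Sigma>)"
  shows "norm \<mu>' = norm \<mu> \<and> same_eigenvalues \<Sigma>' \<Sigma>"
proof -
  \<comment> \<open>Since (\<mu>, \<Sigma>) lies in \<open>gaussians\<close>, the restricted
    function \<open>gaussian_action A\<close> takes its explicit value there.\<close>
  obtain A where A: "orthogonal_matrix A"
    and eq: "\<mu>' = A *v \<mu>" "\<Sigma>' = A ** \<Sigma> ** transpose A"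
    using assms by (auto simp: orbit_def orthogonal_group_def gaussian_action_def)
  have "orthogonal_transformation ((*v) A)"
    using A by (simp add: orthogonal_transformation_matrix)
  then have "norm \<mu>' = norm \<mu>"
    by (simp add: eq orthogonal_transformation_norm)
  with same_eigenvalues_orthogonal_conjugate[OF A] show ?thesis
    by (simp add: eq)
qed

end
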